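(* Let $L$ be the transfer operator of $T$, let $H\subseteq X$ be a Borel set (the hole), and let $L_H f=1_{H^c}\,Lf$ be the transfer operator of the system with hole. Let $\mathcal{S}\subseteq\mathcal{W}\subseteq SM(X)$ be vector subspaces with norms $\|\cdot\|_s$ on $\mathcal{S}$ and $\|\cdot\|_w$ on $\mathcal{W}$ satisfying $\|f\|_s\ge\|f\|_w$ for all $f\in\mathcal{S}$. Let $\delta>0$, let $L_\delta$ be a linear operator on $\mathcal{W}$, and let $A,B,C,D,\lambda_1,\lambda_2\ge0$ be real constants with $\lambda_1<1$ and $\lambda_2<1$. Assume: (1) for all $f\in\mathcal{S}$ and all $n\ge 1$, $L_H^nf\in\mathcal{S}$ and $\|L_H^nf\|_s\le A\lambda_1^n\|f\|_s+B\|f\|_w$; (2) $L_\delta(\mathcal{S})\subseteq\mathcal{S}$, and for all $g\in\mathcal{S}$ and all $n\ge 1$, $\|(L_\delta^n-L_H^n)g\|_w\le\delta\,(C\|g\|_s+nD\|g\|_w)$; (3) there is an integer $n_1\ge 1$ such that $A\lambda_1^{n_1}<1$ and $\|L_\delta^{n_1}v\|_w\le\lambda_2\|v\|_w$ for all $v\in\mathcal{S}$. Let $$M=\begin{pmatrix} A\lambda_1^{n_1} & B\\ \delta C & \delta n_1D+\lambda_2\end{pmatrix},$$ assume that all entries of $M$ are positive, let $$\rho=\frac{A\lambda_1^{n_1}+\delta n_1D+\lambda_2+\sqrt{(A\lambda_1^{n_1}-\delta n_1D-\lambda_2)^2+4\delta BC}}{2}$$ be its largest eigenvalue, and let $(a,b)$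 be the left eigenvector of $M$ associated with $\rho$, normalized so that $a+b=1$. Then for every $f\in\mathcal{S}$ and every integer $i\ge 1$, $$\begin{pmatrix}\|L_H^{in_1}f\|_s\\ \|L_H^{in_1}f\|_w\end{pmatrix}\preceq M^i\begin{pmatrix}\|f\|_s\\ \|f\|_w\end{pmatrix},$$ where $\preceq$ denotes the componentwise inequality $\le$. In particular, for every $g\in\mathcal{S}$ and every integer $i\ge1$, $$\|L_H^{in_1}g\|_s\le(1/a)\rho^i\|g\|_s\qquad\text{and}\qquad\|L_H^{in_1}g\|_w\le(1/b)\rho^i\|g\|_s.$$
   Context: $X$ is a metric space and $SM(X)$ is the vector space of finite signed Borel measures on $X$. $T\colon X\to X$ is a Borel map. Its transfer operator is the linear operator $L\colon SM(X)\to SM(X)$ defined by $L[\mu](A)=\mu(T^{-1}(A))$ for every Borel set $A\subseteq X$. For a Borel set $H$, $1_{H^c}$ is the indicator function of the complement of $H$, and $1_{H^c}\mu$ denotes the measure $\mu$ restricted to $H^c$, i.e. $(1_{H^c}\mu)(A)=\mu(A\cap H^c)$. The norm $\|\cdot\|_s$ is called the strong norm and $\|\cdot\|_w$ the weak norm. *)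

theory Defs
  imports "HOL-Analysis.Borel_Space" "Jordan_Normal_Form.Char_Poly"
begin

text \<open>
  A finite signed Borel measure is a real-valued countably additive function on the Borel sets.
  To have extensional equality, such a function is extended by \<open>0\<close> to non-Borel sets.
  The property \<open>\<mu> {} = 0\<close> follows from countable additivity applied to \<open>\<lambda>i. {}\<close>.
\<close>

typedef (overloaded) ('a::topological_space) signed_measure =
  "{\<mu> :: 'a set \<Rightarrow> real.
      (\<forall>A. A \<notin> sets borel \<longrightarrow> \<mu> A = 0) \<and>
      (\<forall>A :: nat \<Rightarrow> 'a set. range A \<subseteq> sets borel \<longrightarrow> disjoint_family A \<longrightarrow>
         (\<lambda>i. \<mu> (A i)) sums \<mu> (\<Union>i. A i))}"
  morphisms smeasure Abs_signed_measure
  by (rule exI[of _ "\<lambda>_. 0"]) simp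

setup_lifting type_definition_signed_measure

instantiation signed_measure :: (topological_space) real_vector
begin

lift_definition zero_signed_measure :: "'a signed_measure" is "\<lambda>_. 0"
  by simp

lift_definition plus_signed_measure ::
  "'a signed_measure \<Rightarrow> 'a signed_measure \<Rightarrow> 'a signed_measure"
  is "\<lambda>\<mu> \<nu> A. \<mu> A + \<nu> A"
  by (auto intro!: sums_add)

lift_definition minus_signed_measure ::
  "'a signed_measure \<Rightarrow> 'a signed_measure \<Rightarrow> 'a signed_measure"
  is "\<lambda>\<mu> \<nu> A. \<mu> A - \<nu> A"
  by (auto intro!: sums_diff)

lift_definition uminus_signed_measure :: "'a signed_measure \<Rightarrow> 'a signed_measure"
  is "\<lambda>\<mu> A. - \<mu> A"
  by (auto intro!: sums_minus)

lift_definition scaleR_signed_measure :: "real \<Rightarrow> 'a signed_measure \<Rightarrow> 'a signed_measure"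
  is "\<lambda>c \<mu> A. c * \<mu> A"
  by (auto intro!: sums_mult)

instance
  by standard (transfer, auto simp: fun_eq_iff algebra_simps)+

end

text \<open>
  Both operators below are total; the conditions on measurability of the map and of the
  restricting set only fix junk values (the zero measure) outside the intended use.
\<close>

lift_definition transfer_operator ::
  "('a::topological_space \<Rightarrow> 'a) \<Rightarrow> 'a signed_measure \<Rightarrow> 'a signed_measure"
  is "\<lambda>T \<mu> A. if T \<in> borel_measurable borel \<and> A \<in> sets borel then \<mu> (T -` A) else 0"
proof (intro CollectI conjI allI impI, goal_cases)
  case (1 T \<mu> A)
  then show ?case by simp
next
  case (2 T \<mu> A)
  have sums: "(\<lambda>i. \<mu> (F i)) sums \<mu> (\<Union>i. F i)"
    if "range F \<subseteq> sets borel" "disjoint_family F" for F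
    using 2(1) that by blast
  show ?case
  proof (cases "T \<in> borel_measurable borel")
    case True
    have m: "T -` B \<in> sets borel" if "B \<in> sets borel" for B
      using measurable_sets[OF True that] by simp
    have A: "A i \<in> sets borel" for i
      using 2(2) by auto
    then have U: "(\<Union>i. A i) \<in> sets borel"
      by auto
    have "range (\<lambda>i. T -` A i) \<subseteq> sets borel"
      using A m by blast
    moreover have "disjoint_family (\<lambda>i. T -` A i)"
      using 2(3) unfolding disjoint_family_on_def by blast
    ultimately have "(\<lambda>i. \<mu> (T -` A i)) sums \<mu> (\<Union>i. T -` A i)"
      by (rule sums)
    with True A U show ?thesis
      by (simp add: vimage_UN)
  qed simp
qed

lift_definition restrict_signed_measure ::
  "'a::topological_space set \<Rightarrow> 'a signed_measure \<Rightarrow> 'a signed_measure"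
  is "\<lambda>B \<mu> A. if B \<in> sets borel \<and> A \<in> sets borel then \<mu> (A \<inter> B) else 0"
proof (intro CollectI conjI allI impI, goal_cases)
  case (1 B \<mu> A)
  then show ?case by simp
next
  case (2 B \<mu> A)
  have sums: "(\<lambda>i. \<mu> (F i)) sums \<mu> (\<Union>i. F i)"
    if "range F \<subseteq> sets borel" "disjoint_family F" for F
    using 2(1) that by blast
  show ?case
  proof (cases "B \<in> sets borel")
    case True
    have A: "A i \<in> sets borel" for i
      using 2(2) by auto
    then have U: "(\<Union>i. A i) \<in> sets borel"
      by auto
    have "range (\<lambda>i. A i \<inter> B) \<subseteq> sets borel"
      using A True by auto
    moreover have "disjoint_family (\<lambda>i. A i \<inter> B)"
      using 2(3) unfolding disjoint_family_on_def by blast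
    ultimately have "(\<lambda>i. \<mu> (A i \<inter> B)) sums \<mu> (\<Union>i. A i \<inter> B)"
      by (rule sums)
    moreover have "(\<Union>i. A i \<inter> B) = (\<Union>i. A i) \<inter> B"
      by blast
    ultimately show ?thesis
      using True A U by simp
  qed simp
qed

definition hole_transfer_operator ::
  "('a::topological_space \<Rightarrow> 'a) \<Rightarrow> 'a set \<Rightarrow> 'a signed_measure \<Rightarrow> 'a signed_measure" where
  "hole_transfer_operator T H f = restrict_signed_measure (- H) (transfer_operator T f)"

text \<open>Only the values of the norm and of the linear map on the given subspace matter.\<close>

definition norm_on :: "'v::real_vector set \<Rightarrow> ('v \<Rightarrow> real) \<Rightarrow> bool" where
  "norm_on V N \<longleftrightarrow>
     (\<forall>x\<in>V. 0 \<le> N x \<and> (N x = 0 \<longleftrightarrow> x = 0)) \<and>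
     (\<forall>x\<in>V. \<forall>c. N (c *\<^sub>R x) = \<bar>c\<bar> * N x) \<and>
     (\<forall>x\<in>V. \<forall>y\<in>V. N (x + y) \<le> N x + N y)"

definition linear_operator_on :: "'v::real_vector set \<Rightarrow> ('v \<Rightarrow> 'v) \<Rightarrow> bool" where
  "linear_operator_on V F \<longleftrightarrow>
     F ` V \<subseteq> V \<and>
     (\<forall>x\<in>V. \<forall>y\<in>V. F (x + y) = F x + F y) \<and>
     (\<forall>x\<in>V. \<forall>c. F (c *\<^sub>R x) = c *\<^sub>R F x)"

definition left_eigenvector :: "real mat \<Rightarrow> real vec \<Rightarrow> real \<Rightarrow> bool" where
  "left_eigenvector M v k \<longleftrightarrow> eigenvector (transpose_mat M) v k"

definition largest_eigenvalue :: "real mat \<Rightarrow> real \<Rightarrow> bool" where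
  "largest_eigenvalue M k \<longleftrightarrow> eigenvalue M k \<and> (\<forall>k'. eigenvalue M k' \<longrightarrow> k' \<le> k)"

text \<open>The operators act by the intended formulas and are linear.\<close>

lemma smeasure_transfer_operator:
  assumes "T \<in> borel_measurable borel" and "A \<in> sets borel"
  shows "smeasure (transfer_operator T \<mu>) A = smeasure \<mu> (T -` A)"
  using assms by transfer simp

lemma smeasure_restrict_signed_measure:
  assumes "B \<in> sets borel" and "A \<in> sets borel"
  shows "smeasure (restrict_signed_measure B \<mu>) A = smeasure \<mu> (A \<inter> B)"
  using assms by transfer simp

lemma linear_transfer_operator: "linear (transfer_operator T)"
  by (rule linearI; transfer; auto simp: fun_eq_iff)

lemma linear_restrict_signed_measure: "linear (restrict_signed_measure B)"
  by (rule linearI; transfer; auto simp: fun_eq_iff)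

end

(* Both norms of the iterates under L_H^{n_1} are controlled by one step of M: the first row is
   hypothesis (1), the second comes from comparing L_H^{n_1} with the contraction L_delta^{n_1}.
   Since M is nonnegative, the one-step inequality iterates. Pairing it with the
   left Perron eigenvector (a, b), whose entries are positive, turns M into
   multiplication by rho, and norm_w <= norm_s with a + b = 1 bounds the initial pairing by norm_s g. *)
theory Submission
  imports Defs
begin

text \<open>This leaves both symbols to the scalar product and the indexing of
  \<open>vec\<close>.\<close>

no_notation inner (infix "\<bullet>" 70)
no_notation vec_nth (infixl "$" 90)

section \<open>Nonnegative matrices and componentwise inequalities\<close>

text \<open>The order on vectors includes equality of dimensions, so \<open>u\<close> and
  \<open>w\<close> also have length \<open>n\<close>.\<close>

lemma scalar_prod_mono_right:
  fixes u v w :: "'a::ordered_semiring_0 vec"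
  assumes "0\<^sub>v n \<le> u" and "v \<le> w" and "v \<in> carrier_vec n"
  shows "u \<bullet> v \<le> u \<bullet> w"
  using assms unfolding scalar_prod_def less_eq_vec_def
  by (auto intro!: sum_mono mult_left_mono)

lemma mult_mat_vec_mono:
  fixes M :: "'a::ordered_semiring_0 mat"
  assumes "M \<in> carrier_mat m n" and "\<forall>i<m. 0\<^sub>v n \<le> row M i"
    and "v \<le> w" and "v \<in> carrier_vec n"
  shows "M *\<^sub>v v \<le> M *\<^sub>v w"
  using assms scalar_prod_mono_right[of n _ v w] by (auto simp: less_eq_vec_def)

text \<open>Matrix powers are defined by appending a factor on the right, while iterating an
  inequality puts each new factor on the left.\<close>

lemma pow_mat_Suc_left:
  fixes M :: "'a::semiring_1 mat"
  assumes "M \<in> carrier_mat n n"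
  shows "M ^\<^sub>m Suc i = M * M ^\<^sub>m i"
proof (induction i)
  case 0
  then show ?case using assms by simp
next
  case (Suc i)
  have "M ^\<^sub>m Suc (Suc i) = M * M ^\<^sub>m i * M"
    using Suc by simp
  also have "\<dots> = M * M ^\<^sub>m Suc i"
    using assms by (simp add: assoc_mult_mat[OF assms pow_carrier_mat[OF assms] assms])
  finally show ?case .
qed

text \<open>A matrix with nonnegative rows is monotone on vectors, so it may be applied to both
  sides of the induction hypothesis.\<close>

lemma pow_mat_bound_of_step:
  fixes M :: "'a::linordered_semiring_1 mat"
  assumes M: "M \<in> carrier_mat n n" and nonneg: "\<forall>i<n. 0\<^sub>v n \<le> row M i"
    and x: "\<And>i. x i \<in> carrier_vec n" and step: "\<And>i. x (Suc i) \<le> M *\<^sub>v x i"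
  shows "x i \<le> (M ^\<^sub>m i) *\<^sub>v x 0"
proof (induction i)
  case 0
  then show ?case using M x[of 0] by simp
next
  case (Suc i)
  have "x (Suc i) \<le> M *\<^sub>v x i"
    by (rule step)
  also have "\<dots> \<le> M *\<^sub>v ((M ^\<^sub>m i) *\<^sub>v x 0)"
    by (rule mult_mat_vec_mono[OF M nonneg Suc x])
  also have "\<dots> = (M ^\<^sub>m Suc i) *\<^sub>v x 0"
    unfolding pow_mat_Suc_left[OF M]
    by (rule assoc_mult_mat_vec[OF M pow_carrier_mat[OF M] x, symmetric])
  finally show ?case .
qed

text \<open>Pairing with \<open>u\<close> preserves the step inequality because \<open>u\<close> is
  nonnegative. Transposition then moves \<open>M\<close> onto \<open>u\<close>, where it acts as
  \<open>k\<close>, leaving a scalar recursion.\<close>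

lemma left_eigenvector_bound_of_step:
  assumes M: "M \<in> carrier_mat n n" and u: "left_eigenvector M u k" "0\<^sub>v n \<le> u" and k: "0 \<le> k"
    and x: "\<And>i. x i \<in> carrier_vec n" and step: "\<And>i. x (Suc i) \<le> M *\<^sub>v x i"
  shows "u \<bullet> x i \<le> k ^ i * (u \<bullet> x 0)"
proof (induction i)
  case 0
  then show ?case by simp
next
  case (Suc i)
  have uc: "u \<in> carrier_vec n" and eig: "transpose_mat M *\<^sub>v u = k \<cdot>\<^sub>v u"
    using u(1) M by (auto simp: left_eigenvector_def eigenvector_def)
  have "u \<bullet> x (Suc i) \<le> u \<bullet> (M *\<^sub>v x i)"
    by (rule scalar_prod_mono_right[OF u(2) step x])
  also have "\<dots> = (transpose_mat M *\<^sub>v u) \<bullet> x i"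
    by (rule transpose_vec_mult_scalar[OF M x uc, symmetric])
  also have "\<dots> = k * (u \<bullet> x i)"
    unfolding eig by (rule smult_scalar_prod_distrib[OF uc x])
  also have "\<dots> \<le> k * (k ^ i * (u \<bullet> x 0))"
    using Suc k by (rule mult_left_mono)
  finally show ?case by simp
qed

section \<open>The Perron eigenvalue of a positive two by two matrix\<close>

lemma mat_2_carrier: "mat_of_rows_list 2 [[p, q], [r, s]] \<in> carrier_mat 2 2"
  by (rule carrier_matI) (simp_all add: mat_of_rows_list_def)

lemma vec_of_list_2:
  "vec_of_list [a, b] \<in> carrier_vec 2" "dim_vec (vec_of_list [a, b]) = 2"
  "vec_of_list [a, b] $ 0 = a" "vec_of_list [a, b] $ 1 = b"
  unfolding vec_of_list_index by (auto intro: carrier_vecI simp del: vec_of_list_Cons)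

lemma transpose_mat_2:
  "transpose_mat (mat_of_rows_list 2 [[p, q], [r, s]]) = mat_of_rows_list 2 [[p, r], [q, s]]"
  by (rule eq_matI) (auto simp: mat_of_rows_list_def less_Suc_eq numeral_2_eq_2)

lemma vec_2_eq_iff:
  assumes "dim_vec v = 2" and "dim_vec w = 2"
  shows "v = w \<longleftrightarrow> v $ 0 = w $ 0 \<and> v $ 1 = w $ 1"
  using assms by (auto simp: vec_eq_iff less_2_cases_iff)

lemma vec_2_le_iff:
  assumes "dim_vec v = 2" and "dim_vec w = 2"
  shows "v \<le> w \<longleftrightarrow> v $ 0 \<le> w $ 0 \<and> v $ 1 \<le> w $ 1"
  using assms by (auto simp: less_eq_vec_def less_2_cases_iff)

lemma mult_mat_2_vec:
  assumes "v \<in> carrier_vec 2"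
  shows "(mat_of_rows_list 2 [[p, q], [r, s]] *\<^sub>v v) $ 0 = p * v $ 0 + q * v $ 1"
    and "(mat_of_rows_list 2 [[p, q], [r, s]] *\<^sub>v v) $ 1 = r * v $ 0 + s * v $ 1"
  using assms by (auto simp: mat_of_rows_list_def scalar_prod_def row_def numeral_2_eq_2)

lemma eigenvector_mat_2:
  "eigenvector (mat_of_rows_list 2 [[p, q], [r, s]]) v k \<longleftrightarrow>
     v \<in> carrier_vec 2 \<and> \<not> (v $ 0 = 0 \<and> v $ 1 = 0) \<and>
     p * v $ 0 + q * v $ 1 = k * v $ 0 \<and> r * v $ 0 + s * v $ 1 = k * v $ 1"
proof (cases "v \<in> carrier_vec 2")
  case True
  then show ?thesis
    using carrier_matD(1)[OF mat_2_carrier, of p q r s] mult_mat_2_vec[OF True, of p q r s]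
    by (simp add: eigenvector_def vec_2_eq_iff)
next
  case False
  then show ?thesis
    using carrier_matD(1)[OF mat_2_carrier, of p q r s] by (simp add: eigenvector_def)
qed

lemma left_eigenvector_mat_2:
  "left_eigenvector (mat_of_rows_list 2 [[p, q], [r, s]]) v k \<longleftrightarrow>
     v \<in> carrier_vec 2 \<and> \<not> (v $ 0 = 0 \<and> v $ 1 = 0) \<and>
     p * v $ 0 + r * v $ 1 = k * v $ 0 \<and> q * v $ 0 + s * v $ 1 = k * v $ 1"
  by (simp add: left_eigenvector_def transpose_mat_2 eigenvector_mat_2)

locale positive_mat_2 =
  fixes p q r s :: real
  assumes pos: "0 < p" "0 < q" "0 < r" "0 < s"
begin

definition mat2 :: "real mat" where
  "mat2 = mat_of_rows_list 2 [[p, q], [r, s]]"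

text \<open>The larger root of the characteristic polynomial
  \<open>(t - p) * (t - s) - q * r\<close>.\<close>

definition perron :: real where
  "perron = (p + s + sqrt ((p - s)\<^sup>2 + 4 * q * r)) / 2"

text \<open>Since \<open>q * r\<close> is positive, the square root exceeds the distance of
  \<open>p\<close> and \<open>s\<close>, which pushes the root above their maximum.\<close>

lemma perron_gt: "p < perron" "s < perron"
proof -
  have "\<bar>p - s\<bar> = sqrt ((p - s)\<^sup>2)"
    by simp
  also have "\<dots> < sqrt ((p - s)\<^sup>2 + 4 * q * r)"
    using pos by (intro real_sqrt_less_mono) simp
  finally show "p < perron" "s < perron"
    unfolding perron_def by (auto simp: abs_if split: if_splits)
qed

lemma perron_char: "(perron - p) * (perron - s) = q * r"
proof -
  let ?d = "sqrt ((p - s)\<^sup>2 + 4 * q * r)"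
  have "?d\<^sup>2 = (p - s)\<^sup>2 + 4 * q * r"
    using pos by simp
  moreover have "(perron - p) * (perron - s) = (?d\<^sup>2 - (p - s)\<^sup>2) / 4"
    unfolding perron_def by (simp add: field_simps power2_eq_square)
  ultimately show ?thesis by simp
qed

text \<open>The second coordinate of the eigenvector equation, both for the right eigenvector
  \<open>(q, perron - p)\<close> and for the left one \<open>(r, perron - p)\<close>.\<close>

lemma perron_eq: "q * r + s * (perron - p) = perron * (perron - p)"
  unfolding perron_char[symmetric] by (simp add: algebra_simps)

lemma largest_eigenvalue_perron: "largest_eigenvalue mat2 perron"
  unfolding largest_eigenvalue_def
proof (intro conjI allI impI)
  \<comment> \<open>The witness is chosen to solve the first row of the eigenvector equation
    identically.\<close>
  have "eigenvector mat2 (vec_of_list [q, perron - p]) perron"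
    using pos perron_eq
    unfolding mat2_def eigenvector_mat_2 vec_of_list_2
    by (simp add: vec_of_list_2 algebra_simps del: vec_of_list_Cons)
  then show "eigenvalue mat2 perron"
    by (auto simp: eigenvalue_def)
next
  fix k assume "eigenvalue mat2 k"
  then obtain v where nz: "\<not> (v $ 0 = 0 \<and> v $ 1 = 0)"
    and e0: "p * v $ 0 + q * v $ 1 = k * v $ 0" and e1: "r * v $ 0 + s * v $ 1 = k * v $ 1"
    by (auto simp: eigenvalue_def mat2_def eigenvector_mat_2)
  show "k \<le> perron"
  proof (rule ccontr)
    assume "\<not> k \<le> perron"
    \<comment> \<open>Both factors are positive at \<open>perron\<close> and grow with
      \<open>k\<close>, so no larger \<open>k\<close> is a root of the characteristic
      polynomial.\<close>
    then have "(perron - p) * (perron - s) < (k - p) * (k - s)"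
      using perron_gt by (intro mult_strict_mono) auto
    then have ne: "(k - p) * (k - s) \<noteq> q * r"
      using perron_char by simp
    have "(k - p) * v $ 0 = q * v $ 1" "(k - s) * v $ 1 = r * v $ 0"
      using e0 e1 by (simp_all add: left_diff_distrib)
    then have "(k - p) * (k - s) * v $ 0 = (k - s) * (q * v $ 1)"
      by (metis mult.assoc mult.commute)
    also have "\<dots> = q * r * v $ 0"
      using \<open>(k - s) * v $ 1 = r * v $ 0\<close> by (metis mult.assoc mult.left_commute)
    finally have "(k - p) * (k - s) * v $ 0 = q * r * v $ 0" .
    with ne have "v $ 0 = 0" by simp
    with e0 pos have "v $ 1 = 0" by simp
    with \<open>v $ 0 = 0\<close> nz show False by simp
  qed
qed

text \<open>The first coordinate of the equation makes \<open>v\<close> proportional to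
  \<open>(r, perron - p)\<close>; the normalization fixes the factor, as
  \<open>r + perron - p\<close> is positive.\<close>

lemma left_eigenvector_perron_iff:
  assumes "v $ 0 + v $ 1 = 1"
  shows "left_eigenvector mat2 v perron \<longleftrightarrow>
    v = vec_of_list [r / (r + perron - p), (perron - p) / (r + perron - p)]"
    (is "_ \<longleftrightarrow> v = ?w")
proof -
  define t where "t = r + perron - p"
  have t: "0 < t" using pos perron_gt by (simp add: t_def)
  have w: "?w $ 0 = r / t" "?w $ 1 = (perron - p) / t" "dim_vec ?w = 2"
    by (simp_all only: vec_of_list_2 t_def)
  show ?thesis
  proof
    assume "left_eigenvector mat2 v perron"
    then have v: "dim_vec v = 2" and e: "p * v $ 0 + r * v $ 1 = perron * v $ 0"
      by (auto simp: mat2_def left_eigenvector_mat_2)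
    have v1: "v $ 1 = 1 - v $ 0"
      using assms by simp
    have "v $ 0 * t = r" "v $ 1 * t = perron - p"
      using e unfolding v1 t_def by (simp_all add: algebra_simps)
    then show "v = ?w"
      unfolding vec_2_eq_iff[OF v w(3)] w using t by (simp add: eq_divide_eq)
  next
    assume v: "v = ?w"
    have "p * (r / t) + r * ((perron - p) / t) = perron * (r / t)"
      using t by (simp add: field_simps)
    moreover have "q * (r / t) + s * ((perron - p) / t) = perron * ((perron - p) / t)"
      using perron_eq by (simp add: add_divide_distrib[symmetric])
    ultimately show "left_eigenvector mat2 v perron"
      unfolding v mat2_def left_eigenvector_mat_2 w using t pos vec_of_list_2(1) by simp
  qed
qed

lemma ex1_left_eigenvector_perron:
  "\<exists>!v. left_eigenvector mat2 v perron \<and> v $ 0 + v $ 1 = 1"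
proof -
  let ?w = "vec_of_list [r / (r + perron - p), (perron - p) / (r + perron - p)]"
  have "?w $ 0 + ?w $ 1 = 1"
    using pos perron_gt
    unfolding vec_of_list_2 by (simp add: add_divide_distrib[symmetric])
  then show ?thesis
    using left_eigenvector_perron_iff by blast
qed

text \<open>Strict positivity is what later allows division by \<open>a\<close> and
  \<open>b\<close>.\<close>

lemma left_eigenvector_perron_pos:
  assumes "left_eigenvector mat2 v perron" and "v $ 0 + v $ 1 = 1"
  shows "0 < v $ 0" "0 < v $ 1"
proof -
  have v: "v = vec_of_list [r / (r + perron - p), (perron - p) / (r + perron - p)]"
    using left_eigenvector_perron_iff[OF assms(2)] assms(1) by blast
  show "0 < v $ 0" "0 < v $ 1"
    unfolding v vec_of_list_2 using pos perron_gt by simp_all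
qed

end

section \<open>The system with hole\<close>

text \<open>The form needed to bound an iterate of \<open>L_H\<close> by the same iterate of
  \<open>L_delta\<close> plus their difference.\<close>

lemma norm_on_triangle_diff:
  assumes "norm_on V N" and "subspace V" and "x \<in> V" and "y \<in> V"
  shows "N y \<le> N x + N (x - y)"
proof -
  have d: "x - y \<in> V"
    by (rule subspace_diff[OF assms(2-4)])
  have "N ((- 1) *\<^sub>R (x - y)) = \<bar>- 1\<bar> * N (x - y)"
    using assms(1) d unfolding norm_on_def by blast
  moreover have "N (x + (- 1) *\<^sub>R (x - y)) \<le> N x + N ((- 1) *\<^sub>R (x - y))"
    using assms(1,3) subspace_scale[OF assms(2) d, of "- 1"] unfolding norm_on_def by blast
  ultimately show ?thesis by simp
qed

theorem theorem5:
  fixes T :: "'a::metric_space \<Rightarrow> 'a"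
    and H :: "'a set"
    and S W :: "'a signed_measure set"
    and norm_s norm_w :: "'a signed_measure \<Rightarrow> real"
    and L_H L_delta :: "'a signed_measure \<Rightarrow> 'a signed_measure"
    and \<delta> A B C D lam\<^sub>1 lam\<^sub>2 \<rho> :: real
    and n\<^sub>1 :: nat
    and M :: "real mat"
  assumes T: "T \<in> borel_measurable borel"
    and H: "H \<in> sets borel"
    and L_H: "L_H = hole_transfer_operator T H"
    and subspaces: "subspace S" "subspace W" "S \<subseteq> W"
    and norms: "norm_on S norm_s" "norm_on W norm_w"
    and norm_le: "\<forall>f\<in>S. norm_w f \<le> norm_s f"
    and delta_pos: "\<delta> > 0"
    and L_delta: "linear_operator_on W L_delta"
    and nonneg: "A \<ge> 0" "B \<ge> 0" "C \<ge> 0" "D \<ge> 0" "lam\<^sub>1 \<ge> 0" "lam\<^sub>2 \<ge> 0"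
    and lambda_less: "lam\<^sub>1 < 1" "lam\<^sub>2 < 1"
    and hyp1: "\<forall>f\<in>S. \<forall>n\<ge>1. (L_H ^^ n) f \<in> S \<and>
                 norm_s ((L_H ^^ n) f) \<le> A * lam\<^sub>1 ^ n * norm_s f + B * norm_w f"
    and hyp2: "L_delta ` S \<subseteq> S"
              "\<forall>g\<in>S. \<forall>n\<ge>1. norm_w ((L_delta ^^ n) g - (L_H ^^ n) g)
                 \<le> \<delta> * (C * norm_s g + real n * D * norm_w g)"
    and hyp3: "n\<^sub>1 \<ge> 1" "A * lam\<^sub>1 ^ n\<^sub>1 < 1"
              "\<forall>v\<in>S. norm_w ((L_delta ^^ n\<^sub>1) v) \<le> lam\<^sub>2 * norm_w v"
    and M: "M = mat_of_rows_list 2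
                  [[A * lam\<^sub>1 ^ n\<^sub>1, B],
                   [\<delta> * C, \<delta> * real n\<^sub>1 * D + lam\<^sub>2]]"
    and M_pos: "\<forall>i<2. \<forall>j<2. M $$ (i, j) > 0"
    and rho: "\<rho> = (A * lam\<^sub>1 ^ n\<^sub>1 + \<delta> * real n\<^sub>1 * D + lam\<^sub>2
                   + sqrt ((A * lam\<^sub>1 ^ n\<^sub>1 - \<delta> * real n\<^sub>1 * D - lam\<^sub>2)\<^sup>2 + 4 * \<delta> * B * C)) / 2"
  shows "largest_eigenvalue M \<rho> \<and>
    (\<exists>!v. left_eigenvector M v \<rho> \<and> v $ 0 + v $ 1 = 1) \<and>
    (\<forall>f\<in>S. \<forall>i\<ge>1.
       vec_of_list [norm_s ((L_H ^^ (i * n\<^sub>1)) f), norm_w ((L_H ^^ (i * n\<^sub>1)) f)]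
         \<le> (M ^\<^sub>m i) *\<^sub>v vec_of_list [norm_s f, norm_w f]) \<and>
    (\<forall>a b. left_eigenvector M (vec_of_list [a, b]) \<rho> \<and> a + b = 1 \<longrightarrow>
       (\<forall>g\<in>S. \<forall>i\<ge>1.
          norm_s ((L_H ^^ (i * n\<^sub>1)) g) \<le> (1 / a) * \<rho> ^ i * norm_s g \<and>
          norm_w ((L_H ^^ (i * n\<^sub>1)) g) \<le> (1 / b) * \<rho> ^ i * norm_s g))"
proof -
  define q s where "q = \<delta> * C" and "s = \<delta> * real n\<^sub>1 * D + lam\<^sub>2"
  define p where "p = A * lam\<^sub>1 ^ n\<^sub>1"
  have Mrows: "M = mat_of_rows_list 2 [[p, B], [q, s]]"
    by (simp add: M p_def q_def s_def)
  have "0 < p" "0 < B" "0 < q" "0 < s"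
    using M_pos[rule_format, of 0 0] M_pos[rule_format, of 0 1]
      M_pos[rule_format, of 1 0] M_pos[rule_format, of 1 1]
    by (auto simp: Mrows mat_of_rows_list_def)
  \<comment> \<open>The off-diagonal entries shift names: \<open>B\<close> is the \<open>q\<close>
    of the locale, and the local \<open>q\<close> is its \<open>r\<close>.\<close>
  then interpret P: positive_mat_2 p B q s
    by unfold_locales
  have M2: "M = P.mat2"
    unfolding Mrows P.mat2_def ..
  have rho2: "\<rho> = P.perron"
    unfolding rho P.perron_def by (simp add: p_def q_def s_def algebra_simps)
  have Mc: "M \<in> carrier_mat 2 2"
    unfolding Mrows by (rule mat_2_carrier)
  have Mrow: "\<forall>i<2. 0\<^sub>v 2 \<le> row M i"
    using Mc M_pos by (auto simp: less_eq_vec_def intro!: less_imp_le)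
  have rho_nonneg: "0 \<le> \<rho>"
    using P.perron_gt(1) P.pos(1) rho2 by simp

  \<comment> \<open>The index \<open>i\<close> counts blocks of \<open>n\<^sub>1\<close> iterations,
    so one step of \<open>x\<close> matches one factor \<open>M\<close>.\<close>
  define x where "x f i = vec_of_list [norm_s ((L_H ^^ (i * n\<^sub>1)) f), norm_w ((L_H ^^ (i * n\<^sub>1)) f)]"
    for f i
  have x: "x f i \<in> carrier_vec 2" "x f i $ 0 = norm_s ((L_H ^^ (i * n\<^sub>1)) f)"
    "x f i $ 1 = norm_w ((L_H ^^ (i * n\<^sub>1)) f)" for f i
    unfolding x_def by (rule vec_of_list_2)+
  have x0: "x f 0 = vec_of_list [norm_s f, norm_w f]" for f
    by (simp add: x_def)
  \<comment> \<open>\<open>hyp1\<close> speaks only of positive \<open>n\<close>; for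
    \<open>n = 0\<close> the iterate is \<open>f\<close> itself.\<close>
  have iter_S: "(L_H ^^ n) f \<in> S" if "f \<in> S" for f n
    using hyp1 that by (cases "n = 0") (auto simp: Suc_le_eq)
  have delta_S: "(L_delta ^^ n) f \<in> S" if "f \<in> S" for f n
    using that hyp2(1) by (induction n) auto

  have one_step_w: "norm_w ((L_H ^^ n\<^sub>1) g) \<le> q * norm_s g + s * norm_w g" if g: "g \<in> S" for g
  proof -
    have "norm_w ((L_H ^^ n\<^sub>1) g)
        \<le> norm_w ((L_delta ^^ n\<^sub>1) g) + norm_w ((L_delta ^^ n\<^sub>1) g - (L_H ^^ n\<^sub>1) g)"
      using norm_on_triangle_diff[OF norms(2) subspaces(2)] iter_S[OF g] delta_S[OF g] subspaces(3)
      by blast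
    moreover have "norm_w ((L_delta ^^ n\<^sub>1) g) \<le> lam\<^sub>2 * norm_w g"
      using hyp3(3) g by blast
    moreover have "norm_w ((L_delta ^^ n\<^sub>1) g - (L_H ^^ n\<^sub>1) g)
        \<le> \<delta> * (C * norm_s g + real n\<^sub>1 * D * norm_w g)"
      using hyp2(2) hyp3(1) g by blast
    ultimately show ?thesis
      by (simp add: q_def s_def algebra_simps)
  qed
  have step: "x f (Suc i) \<le> M *\<^sub>v x f i" if f: "f \<in> S" for f i
  proof -
    let ?g = "(L_H ^^ (i * n\<^sub>1)) f"
    have g: "?g \<in> S" by (rule iter_S[OF f])
    have "(L_H ^^ (Suc i * n\<^sub>1)) f = (L_H ^^ n\<^sub>1) ?g"
      by (simp add: funpow_add)
    moreover have "norm_s ((L_H ^^ n\<^sub>1) ?g) \<le> p * norm_s ?g + B * norm_w ?g"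
      using hyp1 hyp3(1) g unfolding p_def by blast
    ultimately have "x f (Suc i) $ 0 \<le> (M *\<^sub>v x f i) $ 0 \<and> x f (Suc i) $ 1 \<le> (M *\<^sub>v x f i) $ 1"
      using one_step_w[OF g] unfolding Mrows mult_mat_2_vec[OF x(1)] x(2,3) by simp
    then show ?thesis
      using Mc x(1) by (subst vec_2_le_iff) auto
  qed

  show ?thesis
  proof (intro conjI ballI allI impI)
    \<comment> \<open>This and the next conjunct justify speaking of the largest eigenvalue and of
      the normalized left eigenvector.\<close>
    show "largest_eigenvalue M \<rho>"
      unfolding M2 rho2 by (rule P.largest_eigenvalue_perron)
    show "\<exists>!v. left_eigenvector M v \<rho> \<and> v $ 0 + v $ 1 = 1"
      unfolding M2 rho2 by (rule P.ex1_left_eigenvector_perron)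
  next
    fix f and i :: nat assume f: "f \<in> S"
    show "vec_of_list [norm_s ((L_H ^^ (i * n\<^sub>1)) f), norm_w ((L_H ^^ (i * n\<^sub>1)) f)]
        \<le> (M ^\<^sub>m i) *\<^sub>v vec_of_list [norm_s f, norm_w f]"
      using pow_mat_bound_of_step[of M 2 "x f", OF Mc Mrow x(1) step[OF f], of i]
      \<comment> \<open>The initial vector is rewritten first, before \<open>x_def\<close> could
        expose it as an iterate of order \<open>0 * n\<^sub>1\<close>.\<close>
      unfolding x0 unfolding x_def .
  next
    fix a b g and i :: nat
    assume eig: "left_eigenvector M (vec_of_list [a, b]) \<rho> \<and> a + b = 1" and g: "g \<in> S"
    let ?u = "vec_of_list [a, b]" and ?g = "(L_H ^^ (i * n\<^sub>1)) g"
    note u = vec_of_list_2[of a b]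
    have ab: "0 < a" "0 < b"
      using P.left_eigenvector_perron_pos[of ?u] eig unfolding u M2 rho2 by blast+
    have dot: "?u \<bullet> x g j = a * norm_s ((L_H ^^ (j * n\<^sub>1)) g) + b * norm_w ((L_H ^^ (j * n\<^sub>1)) g)" for j
      using x(1)[of g j] x(2,3)[of g j] u
      by (simp add: scalar_prod_def numeral_2_eq_2 del: vec_of_list_Cons)
    have "0\<^sub>v 2 \<le> ?u"
      using ab u by (simp add: vec_2_le_iff del: vec_of_list_Cons)
    then have "?u \<bullet> x g i \<le> \<rho> ^ i * (?u \<bullet> x g 0)"
      using left_eigenvector_bound_of_step[of M 2 ?u \<rho> "x g" i] Mc eig rho_nonneg x(1) step[OF g]
      by blast
    moreover have "?u \<bullet> x g 0 \<le> norm_s g"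
    proof -
      \<comment> \<open>The weak norm is replaced by the strong one, so that the weights add up to
        1.\<close>
      have "b * norm_w g \<le> b * norm_s g"
        using norm_le g ab by simp
      then have "a * norm_s g + b * norm_w g \<le> (a + b) * norm_s g"
        by (simp add: distrib_right)
      then show ?thesis using eig dot[of 0] by simp
    qed
    ultimately have le: "a * norm_s ?g + b * norm_w ?g \<le> \<rho> ^ i * norm_s g"
      using rho_nonneg dot[of i]
      by (smt (verit) mult_left_mono zero_le_power)
    \<comment> \<open>Both summands on the left of \<open>le\<close> are nonnegative, so each alone
      obeys the bound on their sum.\<close>
    have "0 \<le> norm_s ?g" "0 \<le> norm_w ?g"
      using norms iter_S[OF g, of "i * n\<^sub>1"] subsetD[OF subspaces(3), of ?g]
      by (simp_all add: norm_on_def)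
    with ab have "0 \<le> a * norm_s ?g" "0 \<le> b * norm_w ?g"
      by simp_all
    with le have "a * norm_s ?g \<le> \<rho> ^ i * norm_s g" "b * norm_w ?g \<le> \<rho> ^ i * norm_s g"
      by linarith+
    with ab show "norm_s ?g \<le> (1 / a) * \<rho> ^ i * norm_s g" "norm_w ?g \<le> (1 / b) * \<rho> ^ i * norm_s g"
      by (simp_all add: field_simps)
  qed
qed

end
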